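(* Let $T$ be any AVL tree with $n$ nodes (a binary search tree on $n$ distinct keys, together with the ranks required by the AVL rank rule). Then there is an ordering of the $n$ keys of $T$ such that, starting from the empty tree and inserting these keys one by one in that order using the AVL insertion algorithm described below, the final tree is exactly $T$ (same shape, same keys, same ranks), and every one of these $n$ insertions performs only promotions during rebalancing (no single or double rotations).
   Context: A ranked binary tree is a binary tree in which each node $x$ has a non-negative integer rank $x.r$; a missing node (absent child) has rank $-1$. For a child $x$ with parent $p$, its rank difference is $p.r - x.r$; a child with rank difference $i$ is an $i$-child, and a node whose two children (possibly missing) have rank differences $i \le j$ is an $i,j$ node. An AVL tree is a ranked binary tree in which every node is $1,1$ or $1,2$ (so leaves have rank $0$ and ranks equal heights). The trees are binary search trees: nodes carry distinct keys in symmetric (in-)order. AVL insertion of a new key: replace the missing node at the position determined by binary search for the key with a new leaf of rank $0$. Then, while some node $p$ has a $0$-child $x$ (a violation), apply: (Promotion) if the sibling of $x$ is a $1$-child of $p$ (so $p$ is $0,1$), increase $p.r$ by $1$ and continue checking at $p$'s parent; otherwise $p$ is $0,2$, and let $z$ be the child of $x$ on the side opposite to the side $x$ is on relative to $p$: (Single rotation) if $z$ is missing-or-a-$2$-child of $x$, rotate at $x$ (making $x$ the parent of $p$) and decrease $p.r$ by $1$, then stop; (Double rotation) otherwise ($z$ is a $1$-child of $x$), do a double rotation making $z$ the parent of both $x$ and $p$, increase $z.r$ by $1$ and decrease both $x.r$ and $p.r$ by $1$, then stop. A rotation is the standard local restructuring preserving symmetric order. *)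

theory Defs
  imports Main "HOL-Library.Tree"
begin

text \<open>
  A ranked tree over keys of type \<open>'a\<close> is a \<open>('a \<times> nat) tree\<close>: each node stores its key and its
  rank; \<open>Leaf\<close> is a missing node.
\<close>

type_synonym 'a rtree = "('a \<times> nat) tree"

fun rank :: "'a rtree \<Rightarrow> int" where
  "rank Leaf = -1"
| "rank (Node _ (_, r) _) = int r"

definition rank_diff :: "nat \<Rightarrow> 'a rtree \<Rightarrow> int" where
  "rank_diff r c = int r - rank c"

text \<open>\<open>ij_node i j l r t\<close>: a node of rank \<open>r\<close> with children \<open>l\<close> and \<open>t\<close> is an \<open>i,j\<close> node.\<close>

definition ij_node :: "int \<Rightarrow> int \<Rightarrow> 'a rtree \<Rightarrow> nat \<Rightarrow> 'a rtree \<Rightarrow> bool" where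
  "ij_node i j l r t \<longleftrightarrow>
     min (rank_diff r l) (rank_diff r t) = i \<and> max (rank_diff r l) (rank_diff r t) = j"

fun avl :: "'a rtree \<Rightarrow> bool" where
  "avl Leaf \<longleftrightarrow> True"
| "avl (Node l (_, r) t) \<longleftrightarrow> (ij_node 1 1 l r t \<or> ij_node 1 2 l r t) \<and> avl l \<and> avl t"

datatype rebalancing_op = Promotion | Single_Rotation | Double_Rotation

text \<open>
  One iteration of the rebalancing loop at a node \<open>p\<close> with key \<open>a\<close> and rank \<open>r\<close>, where the child
  \<open>x\<close> on the insertion path is the left (\<open>fix_left\<close>) or right (\<open>fix_right\<close>) child.  The result is
  paired with the operations performed.  In the rotation cases the sibling is a 2-child, so
  \<open>r \<ge> 1\<close> and the subtractions on \<open>nat\<close> do not truncate.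
  The \<open>Leaf\<close> alternatives of the case expressions are unreachable.
\<close>

definition fix_left :: "'a rtree \<Rightarrow> 'a \<Rightarrow> nat \<Rightarrow> 'a rtree \<Rightarrow> 'a rtree \<times> rebalancing_op list" where
  "fix_left x a r y =
     (if rank_diff r x \<noteq> 0 then (Node x (a, r) y, [])
      else if rank_diff r y = 1 then (Node x (a, r + 1) y, [Promotion])
      else case x of
        Leaf \<Rightarrow> (Node x (a, r) y, [])
      | Node w (b, s) z \<Rightarrow>
          if z = Leaf \<or> rank_diff s z = 2
          then (Node w (b, s) (Node z (a, r - 1) y), [Single_Rotation])
          else case z of
            Leaf \<Rightarrow> (Node x (a, r) y, [])
          | Node u (c, q) v \<Rightarrow>
              (Node (Node w (b, s - 1) u) (c, q + 1) (Node v (a, r - 1) y), [Double_Rotation]))"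

definition fix_right :: "'a rtree \<Rightarrow> 'a \<Rightarrow> nat \<Rightarrow> 'a rtree \<Rightarrow> 'a rtree \<times> rebalancing_op list" where
  "fix_right y a r x =
     (if rank_diff r x \<noteq> 0 then (Node y (a, r) x, [])
      else if rank_diff r y = 1 then (Node y (a, r + 1) x, [Promotion])
      else case x of
        Leaf \<Rightarrow> (Node y (a, r) x, [])
      | Node z (b, s) w \<Rightarrow>
          if z = Leaf \<or> rank_diff s z = 2
          then (Node (Node y (a, r - 1) z) (b, s) w, [Single_Rotation])
          else case z of
            Leaf \<Rightarrow> (Node y (a, r) x, [])
          | Node u (c, q) v \<Rightarrow>
              (Node (Node y (a, r - 1) u) (c, q + 1) (Node v (b, s - 1) w), [Double_Rotation]))"

text \<open>
  The list records the operations in the order performed, i.e. bottom-up.  In an AVL tree, after a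
  rotation the rank of the subtree is what it was before the insertion, so the checks at the
  remaining ancestors find no 0-child and the rebalancing stops there.  Inserting a key already present does nothing.
\<close>

fun avl_insert :: "'a::linorder \<Rightarrow> 'a rtree \<Rightarrow> 'a rtree \<times> rebalancing_op list" where
  "avl_insert k Leaf = (Node Leaf (k, 0) Leaf, [])"
| "avl_insert k (Node l (a, r) t) =
     (if k < a then
        (let (l', ops) = avl_insert k l; (p', ops') = fix_left l' a r t in (p', ops @ ops'))
      else if a < k then
        (let (t', ops) = avl_insert k t; (p', ops') = fix_right l a r t' in (p', ops @ ops'))
      else (Node l (a, r) t, []))"

definition avl_build :: "'a::linorder list \<Rightarrow> 'a rtree" where
  "avl_build ks = fold (\<lambda>k t. fst (avl_insert k t)) ks Leaf"

end

theory Submission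
  imports Defs
begin

text \<open>
  The insertions are undone one at a time.  In a nonempty AVL tree, descend from the root through
  1-children to a leaf, delete that leaf, and walk back up as long as the rank of the current
  subtree has dropped: a 1,2 node has lost rank in its 1-child and is demoted to a 1,1 node, whereas
  a 1,1 node simply becomes a 1,2 node and the walk ends.  Re-inserting the deleted key promotes
  exactly the demoted nodes.
\<close>

lemma rank_ge_minus_one: "-1 \<le> rank t"
  by (cases t rule: rank.cases) auto

lemma rank_eq_minus_one_iff: "rank t = -1 \<longleftrightarrow> t = Leaf"
  by (cases t rule: rank.cases) auto

text \<open>Eliminating \<open>min\<close> and \<open>max\<close> leaves three linear cases, so rank
  changes can be settled by arithmetic.\<close>

lemma avl_Node_iff:
  "avl (Node l (a, r) t) \<longleftrightarrow> avl l \<and> avl t \<and>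
     (rank l = int r - 1 \<and> rank t = int r - 1 \<or>
      rank l = int r - 1 \<and> rank t = int r - 2 \<or>
      rank l = int r - 2 \<and> rank t = int r - 1)"
  by (auto simp: ij_node_def rank_diff_def min_def max_def)

lemma fst_set_tree_Node:
  "fst ` set_tree (Node l (a, r) t) = insert a (fst ` set_tree l \<union> fst ` set_tree t)"
  by auto

lemma bst_map_fst_Node:
  "bst (map_tree fst (Node l (a, r) t)) \<longleftrightarrow>
     bst (map_tree fst l) \<and> bst (map_tree fst t) \<and>
     (\<forall>x \<in> fst ` set_tree l. x < a) \<and> (\<forall>x \<in> fst ` set_tree t. a < x)"
  by (auto simp: tree.set_map)

text \<open>The clause on ranks is what carries the induction: the parent of \<open>T\<close> must
  know that passing to \<open>T'\<close> lowers the rank by at most one. The clauses on keys and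
  size serve the final ordering.\<close>

definition promotion_pred :: "'a::linorder \<Rightarrow> 'a rtree \<Rightarrow> 'a rtree \<Rightarrow> bool" where
  "promotion_pred k T' T \<longleftrightarrow>
     avl T' \<and> bst (map_tree fst T') \<and> k \<notin> fst ` set_tree T' \<and>
     fst ` set_tree T = insert k (fst ` set_tree T') \<and> size T = Suc (size T') \<and>
     (rank T' = rank T \<or> rank T' = rank T - 1) \<and>
     fst (avl_insert k T') = T \<and> set (snd (avl_insert k T')) \<subseteq> {Promotion}"

text \<open>The smaller child has rank \<open>r - 1\<close> or \<open>r - 2\<close>, since
  \<open>l\<close> is a 1-child. Had a 2-child lost rank, a rank difference of 3 could
  arise.\<close>

lemma promotion_pred_left:
  assumes pred: "promotion_pred k l' l"
    and avl: "avl (Node l (a, r) t)"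
    and bst: "bst (map_tree fst (Node l (a, r) t))"
    and rank: "rank l = int r - 1"
  shows "\<exists>T'. promotion_pred k T' (Node l (a, r) t)"
proof -
  obtain ops where ins: "avl_insert k l' = (l, ops)" and ops: "set ops \<subseteq> {Promotion}"
    using pred by (cases "avl_insert k l'") (auto simp: promotion_pred_def)
  have "k \<in> fst ` set_tree l"
    using pred unfolding promotion_pred_def by simp
  then have k: "k < a"
    using bst unfolding bst_map_fst_Node by auto
  from k have kt: "k \<notin> fst ` set_tree t"
    using bst unfolding bst_map_fst_Node by (meson less_asym)
  have l': "avl l'" "bst (map_tree fst l')" "k \<notin> fst ` set_tree l'"
    "fst ` set_tree l = insert k (fst ` set_tree l')" "size l = Suc (size l')"
    "rank l' = rank l \<or> rank l' = rank l - 1"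
    using pred by (auto simp: promotion_pred_def)
  \<comment> \<open>Demotion is needed exactly when \<open>l\<close> loses rank and \<open>t\<close>
    is a 2-child, which would leave a 2,2 node. With \<open>t\<close> a 1-child, the loss merely
    gives a 1,2 node.\<close>
  define r' where "r' = (if rank l' = rank l - 1 \<and> rank t = int r - 2 then r - 1 else r)"
  \<comment> \<open>A 2-child has rank at least -1, so the subtraction \<open>r - 1\<close> on
    naturals does not truncate.\<close>
  have r: "rank t = int r - 2 \<Longrightarrow> 1 \<le> r"
    using rank_ge_minus_one[of t] by auto
  have "avl (Node l' (a, r') t)"
    using avl rank l'(1,6) r unfolding avl_Node_iff r'_def by auto
  moreover have "bst (map_tree fst (Node l' (a, r') t))"
    using bst l' unfolding bst_map_fst_Node by auto
  \<comment> \<open>If \<open>r' = r\<close>, the restored \<open>l\<close> is a 1-child and nothing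
    happens here. If \<open>r' = r - 1\<close>, it is a 0-child whose sibling \<open>t\<close> is a
    1-child, so one promotion restores \<open>r\<close>.\<close>
  moreover have "fst (avl_insert k (Node l' (a, r') t)) = Node l (a, r) t"
    "set (snd (avl_insert k (Node l' (a, r') t))) \<subseteq> {Promotion}"
    using k ins ops rank r by (auto simp: fix_left_def rank_diff_def r'_def)
  moreover have "rank (Node l' (a, r') t) = rank (Node l (a, r) t) \<or>
      rank (Node l' (a, r') t) = rank (Node l (a, r) t) - 1"
    using r by (auto simp: r'_def)
  moreover have "k \<notin> fst ` set_tree (Node l' (a, r') t)"
    using k kt l'(3) unfolding fst_set_tree_Node by auto
  moreover have "fst ` set_tree (Node l (a, r) t) = insert k (fst ` set_tree (Node l' (a, r') t))"
    using l'(4) unfolding fst_set_tree_Node by auto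
  moreover have "size (Node l (a, r) t) = Suc (size (Node l' (a, r') t))"
    using l'(5) by simp
  ultimately show ?thesis
    unfolding promotion_pred_def by blast
qed

text \<open>Mirror image of \<open>promotion_pred_left\<close>, with \<open>fix_right\<close> in
  place of \<open>fix_left\<close>.\<close>

lemma promotion_pred_right:
  assumes pred: "promotion_pred k t' t"
    and avl: "avl (Node l (a, r) t)"
    and bst: "bst (map_tree fst (Node l (a, r) t))"
    and rank: "rank t = int r - 1"
  shows "\<exists>T'. promotion_pred k T' (Node l (a, r) t)"
proof -
  obtain ops where ins: "avl_insert k t' = (t, ops)" and ops: "set ops \<subseteq> {Promotion}"
    using pred by (cases "avl_insert k t'") (auto simp: promotion_pred_def)
  have "k \<in> fst ` set_tree t"
    using pred unfolding promotion_pred_def by simp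
  then have k: "a < k"
    using bst unfolding bst_map_fst_Node by auto
  from k have kl: "k \<notin> fst ` set_tree l"
    using bst unfolding bst_map_fst_Node by (meson less_asym)
  have t': "avl t'" "bst (map_tree fst t')" "k \<notin> fst ` set_tree t'"
    "fst ` set_tree t = insert k (fst ` set_tree t')" "size t = Suc (size t')"
    "rank t' = rank t \<or> rank t' = rank t - 1"
    using pred by (auto simp: promotion_pred_def)
  define r' where "r' = (if rank t' = rank t - 1 \<and> rank l = int r - 2 then r - 1 else r)"
  have r: "rank l = int r - 2 \<Longrightarrow> 1 \<le> r"
    using rank_ge_minus_one[of l] by auto
  have "avl (Node l (a, r') t')"
    using avl rank t'(1,6) r unfolding avl_Node_iff r'_def by auto
  moreover have "bst (map_tree fst (Node l (a, r') t'))"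
    using bst t' unfolding bst_map_fst_Node by auto
  moreover have "fst (avl_insert k (Node l (a, r') t')) = Node l (a, r) t"
    "set (snd (avl_insert k (Node l (a, r') t'))) \<subseteq> {Promotion}"
    using k ins ops rank r by (auto simp: fix_right_def rank_diff_def r'_def)
  moreover have "rank (Node l (a, r') t') = rank (Node l (a, r) t) \<or>
      rank (Node l (a, r') t') = rank (Node l (a, r) t) - 1"
    using r by (auto simp: r'_def)
  moreover have "k \<notin> fst ` set_tree (Node l (a, r') t')"
    using k kl t'(3) unfolding fst_set_tree_Node by auto
  moreover have "fst ` set_tree (Node l (a, r) t) = insert k (fst ` set_tree (Node l (a, r') t'))"
    using t'(4) unfolding fst_set_tree_Node by auto
  moreover have "size (Node l (a, r) t) = Suc (size (Node l (a, r') t'))"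
    using t'(5) by simp
  ultimately show ?thesis
    unfolding promotion_pred_def by blast
qed

lemma promotion_pred_exists:
  assumes "avl T" "bst (map_tree fst T)" "T \<noteq> Leaf"
  shows "\<exists>k T'. promotion_pred k T' T"
  using assms
proof (induction T)
  case Leaf
  then show ?case by simp
next
  case (Node l p t)
  obtain a r where p: "p = (a, r)" by (cases p)
  note avl = Node.prems(1)[unfolded p] and bst = Node.prems(2)[unfolded p]
  have sub: "avl l" "avl t" "bst (map_tree fst l)" "bst (map_tree fst t)"
    using avl bst unfolding avl_Node_iff bst_map_fst_Node by auto
  show ?case
  proof (cases "r = 0")
    case True
    \<comment> \<open>Below a node of rank 0 only rank -1 is possible, so the node is a leaf and
      deleting it gives the empty tree.\<close>
    then have "l = Leaf" "t = Leaf"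
      using avl rank_ge_minus_one[of l] rank_ge_minus_one[of t]
      unfolding avl_Node_iff rank_eq_minus_one_iff[symmetric] by auto
    then have "promotion_pred a Leaf (Node l p t)"
      using True by (simp add: promotion_pred_def p)
    then show ?thesis by blast
  next
    case False
    \<comment> \<open>The rank rule excludes 2,2 nodes, so there is a 1-child; since
      \<open>r\<close> is positive, its rank is non-negative and it is not missing.\<close>
    consider "rank l = int r - 1" | "rank t = int r - 1"
      using avl unfolding avl_Node_iff by auto
    then show ?thesis
    proof cases
      case 1
      then have "l \<noteq> Leaf" using False by auto
      then show ?thesis
        using Node.IH(1) sub promotion_pred_left[OF _ avl bst 1] unfolding p by blast
    next
      case 2
      then have "t \<noteq> Leaf" using False by auto
      then show ?thesis
        using Node.IH(2) sub promotion_pred_right[OF _ avl bst 2] unfolding p by blast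
    qed
  qed
qed

theorem theorem1:
  fixes T :: "('a::linorder \<times> nat) tree" and n :: nat
  assumes "avl T"
    and "bst (map_tree fst T)"
    and "size T = n"
  shows "\<exists>ks :: 'a list. length ks = n \<and> distinct ks \<and> set ks = fst ` set_tree T \<and>
           avl_build ks = T \<and>
           (\<forall>i<n. set (snd (avl_insert (ks ! i) (avl_build (take i ks)))) \<subseteq> {Promotion})"
  using assms
proof (induction n arbitrary: T)
  case 0
  then show ?case by (simp add: avl_build_def)
next
  case (Suc n)
  then have "T \<noteq> Leaf" by auto
  then obtain k T' where pred: "promotion_pred k T' T"
    using promotion_pred_exists Suc.prems by blast
  then have "avl T'" "bst (map_tree fst T')" "size T' = n"
    using Suc.prems(3) by (auto simp: promotion_pred_def)
  from Suc.IH[OF this] obtain ks where ks: "length ks = n" "distinct ks"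
    "set ks = fst ` set_tree T'" "avl_build ks = T'"
    "\<forall>i<n. set (snd (avl_insert (ks ! i) (avl_build (take i ks)))) \<subseteq> {Promotion}"
    by blast
  \<comment> \<open>The key removed first from \<open>T\<close> is inserted last.\<close>
  have "avl_build (ks @ [k]) = T"
    using pred ks(4) by (simp add: avl_build_def promotion_pred_def)
  moreover have "set (snd (avl_insert ((ks @ [k]) ! i) (avl_build (take i (ks @ [k]))))) \<subseteq> {Promotion}"
    if "i < Suc n" for i
  \<comment> \<open>Index \<open>n\<close> is the insertion of \<open>k\<close> into
    \<open>T'\<close>; every earlier step only sees a prefix of \<open>ks\<close>.\<close>
  proof (cases "i = n")
    case True
    then show ?thesis using pred ks by (simp add: promotion_pred_def nth_append)
  next
    case False
    then show ?thesis using that ks by (simp add: nth_append)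
  qed
  moreover have "distinct (ks @ [k])" "set (ks @ [k]) = fst ` set_tree T"
    using pred ks by (auto simp: promotion_pred_def)
  ultimately show ?case
    using ks(1) by (intro exI[of _ "ks @ [k]"]) auto
qed

end
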